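(* Let $T>0$, let $f:[0,T]\times\mathbb{R}^n\to\mathbb{R}^n$ be twice continuously differentiable, and let $x_0\in\mathbb{R}^n$ be such that the solution $x(t;x_0)$ of the initial value problem $\dot{x}(t)=f(t,x(t))$, $x(0)=x_0$, exists on all of $[0,T]$. Let $\mathrm{P}(t)$ be the matrix of adjoint functions along $x(\cdot;x_0)$ normalized at $t=T$, as defined in the context. Then $$\frac{\partial x(T;x_0)}{\partial x_0}=\mathrm{P}(0)^{\mathrm{T}}.$$
   Context: For an initial value $x_0\in\mathbb{R}^n$, $x(t;x_0)$ denotes the solution of $\dot{x}(t)=f(t,x(t))$ on $[0,T]$ with $x(0)=x_0$. $\frac{\partial x(T;x_0)}{\partial x_0}$ is the $n\times n$ Jacobian matrix of the map $x_0\mapsto x(T;x_0)$, whose $(j,k)$ entry is $\frac{\partial x_j(T;x_0)}{\partial x_{0,k}}$. Write $f_x'(t,x)=\frac{\partial f(t,x)}{\partial x}$ for the Jacobian matrix of $f$ with respect to $x$, and let the superscript $^{\mathrm{T}}$ denote the transpose of a matrix. The adjoint differential system along $x(t)=x(t;x_0)$ is $$\dot{p}(t)=-f_x'(t,x(t))^{\mathrm{T}}\,p(t),\qquad t\in[0,T],$$ and a solution $p:[0,T]\to\mathbb{R}^n$ of it is called an adjoint function. For $j\in\{1,\ldots,n\}$, $p^j(t)=(p^j_1(t),\ldots,p^j_n(t))^{\mathrm{T}}$ is the adjoint function satisfying $p^j(T)=e_j$, where $e_j$ is the $j$-th vector of the canonical basis of $\mathbb{R}^n$. $\mathrm{P}(t)=[p^1(t)\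 p^2(t)\ \ldots\ p^n(t)]$ is the $n\times n$ matrix whose $j$-th column is $p^j(t)$. *)

theory Defs
  imports "HOL-Analysis.Analysis"
begin

text \<open>Derivatives are taken within \<open>S\<close>, so they are one-sided at boundary points of \<open>S\<close>.
  On \<open>S = {0..T} \<times> UNIV\<close> with \<open>T > 0\<close> they are uniquely determined.  Continuity of \<open>g\<close> and
  \<open>g'\<close> follows from their differentiability.\<close>

definition twice_continuously_differentiable_on ::
  "('a::real_normed_vector \<Rightarrow> 'b::real_normed_vector) \<Rightarrow> 'a set \<Rightarrow> bool" where
  "twice_continuously_differentiable_on g S \<longleftrightarrow>
    (\<exists>(g' :: 'a \<Rightarrow> 'a \<Rightarrow>\<^sub>L 'b) (g'' :: 'a \<Rightarrow> 'a \<Rightarrow>\<^sub>L 'a \<Rightarrow>\<^sub>L 'b).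
      (\<forall>z\<in>S. (g has_derivative blinfun_apply (g' z)) (at z within S)) \<and>
      (\<forall>z\<in>S. (g' has_derivative blinfun_apply (g'' z)) (at z within S)) \<and>
      continuous_on S g'')"

definition ivp_solution ::
  "(real \<Rightarrow> real^'n \<Rightarrow> real^'n) \<Rightarrow> real \<Rightarrow> real^'n \<Rightarrow> (real \<Rightarrow> real^'n) \<Rightarrow> bool" where
  "ivp_solution f T y x \<longleftrightarrow>
    (\<forall>t\<in>{0..T}. (x has_vector_derivative f t (x t)) (at t within {0..T})) \<and> x 0 = y"

text \<open>For continuously differentiable \<open>f\<close>, any two solutions agree on \<open>{0..T}\<close>, so there the
  choice below is immaterial.  The value is unspecified if no solution exists on all of \<open>{0..T}\<close>.\<close>

definition ivp_sol ::
  "(real \<Rightarrow> real^'n \<Rightarrow> real^'n) \<Rightarrow> real \<Rightarrow> real^'n \<Rightarrow> real \<Rightarrow> real^'n" where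
  "ivp_sol f T y = (SOME x. ivp_solution f T y x)"

definition adjoint_function ::
  "(real \<Rightarrow> real^'n \<Rightarrow> real^'n) \<Rightarrow> real \<Rightarrow> (real \<Rightarrow> real^'n) \<Rightarrow> (real \<Rightarrow> real^'n) \<Rightarrow> bool" where
  "adjoint_function f T x p \<longleftrightarrow>
    (\<forall>t\<in>{0..T}. (p has_vector_derivative
        - (transpose (jacobian (f t) (at (x t))) *v p t)) (at t within {0..T}))"

text \<open>Unique on \<open>{0..T}\<close>, the adjoint system being linear with continuous coefficients.\<close>

definition adjoint_basis ::
  "(real \<Rightarrow> real^'n \<Rightarrow> real^'n) \<Rightarrow> real \<Rightarrow> (real \<Rightarrow> real^'n) \<Rightarrow> 'n \<Rightarrow> real \<Rightarrow> real^'n" where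
  "adjoint_basis f T x j = (SOME p. adjoint_function f T x p \<and> p T = axis j 1)"

text \<open>Rows are indexed first: entry \<open>$ i $ j\<close> is the \<open>i\<close>-th component of the \<open>j\<close>-th
  adjoint function, i.e. the adjoint functions are the columns.\<close>

definition adjoint_matrix ::
  "(real \<Rightarrow> real^'n \<Rightarrow> real^'n) \<Rightarrow> real \<Rightarrow> (real \<Rightarrow> real^'n) \<Rightarrow> real \<Rightarrow> real^'n^'n" where
  "adjoint_matrix f T x t = (\<chi> i j. adjoint_basis f T x j t $ i)"

end

theory Submission
  imports Defs
begin

text \<open>No variational equation is needed.  If \<open>z\<close> solves the equation with \<open>z 0 = y\<close> and \<open>p\<close> is an
  adjoint function, the linear terms cancel in the derivative of \<open>p \<bullet> (z - x)\<close>, leaving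
  \<open>p \<bullet> (f t z - f t x - f\<^sub>x (z - x)) = O(|z - x|\<^sup>2)\<close>, which is \<open>O(|y - x0|\<^sup>2)\<close> by Gronwall.
  Taking \<open>p T = e\<^sub>j\<close> and integrating over \<open>{0..T}\<close> gives
  \<open>(z T - x T)\<^sub>j = p 0 \<bullet> (y - x0) + O(|y - x0|\<^sup>2)\<close>, so the gradient of the \<open>j\<close>-th component
  is \<open>p\<^sup>j 0\<close>.\<close>

section \<open>Global existence for Lipschitz differential equations\<close>

text \<open>Picard iteration in the weighted variable \<open>exp (-2 K t) x t\<close>, in which the integral operator is
  a contraction by \<open>1/2\<close> on the whole interval at once.\<close>

lemma lipschitz_ode_solution_exists:
  fixes F :: "real \<Rightarrow> 'a::banach \<Rightarrow> 'a"
  assumes "0 \<le> T"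
    and cont: "continuous_on ({0..T} \<times> UNIV) (\<lambda>(t, x). F t x)"
    and lip: "\<And>t. t \<in> {0..T} \<Longrightarrow> L-lipschitz_on UNIV (F t)"
  obtains x where "x 0 = y"
    and "\<And>t. t \<in> {0..T} \<Longrightarrow> (x has_vector_derivative F t (x t)) (at t within {0..T})"
proof -
  have "0 \<le> L"
    using lipschitz_on_nonneg[OF lip[of 0]] \<open>0 \<le> T\<close> by simp
  define K where "K = L + 1"
  have K: "K > 0" "L \<le> K"
    using \<open>0 \<le> L\<close> by (auto simp: K_def)
  \<comment> \<open>The unknown \<open>\<psi>\<close> stands for
    \<open>exp (- (2 * K * s)) *\<^sub>R x s\<close>, so \<open>G \<psi>\<close> is the vector field
    along the unweighted curve and \<open>u\<close> is the integral operator carried over to the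
    weighted variable.\<close>
  define G where "G \<psi> s = F s (exp (2 * K * s) *\<^sub>R apply_bcontfun \<psi> s)" for \<psi> s
  have contG: "continuous_on {0..T} (G \<psi>)" for \<psi>
    unfolding G_def
    by (rule continuous_on_compose2[OF cont, of _ "\<lambda>s. (s, exp (2 * K * s) *\<^sub>R apply_bcontfun \<psi> s)", simplified])
      (auto intro!: continuous_intros)
  define u where "u \<psi> t = exp (- (2 * K * t)) *\<^sub>R (y + integral {0..t} (G \<psi>))" for \<psi> t
  have contu: "continuous_on {0..T} (u \<psi>)" for \<psi>
    unfolding u_def
    by (intro continuous_intros indefinite_integral_continuous_1 integrable_continuous_real contG)
  \<comment> \<open>Bounded continuous functions on the whole line form a complete space. Clamping
    the argument extends \<open>u \<psi>\<close> from \<open>{0..T}\<close> by its boundary values,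
    so \<open>\<Phi>\<close> acts on that space.\<close>
  define \<Phi> where "\<Phi> \<psi> = Bcontfun (\<lambda>t. u \<psi> (clamp 0 T t))" for \<psi>
  have "(\<lambda>t. u \<psi> (clamp 0 T t)) \<in> bcontfun" for \<psi>
    unfolding bcontfun_def
    using contu[of \<psi>]
    by (auto intro!: clamp_continuous_on clamp_bounded compact_imp_bounded[OF compact_continuous_image])
  then have \<Phi>: "apply_bcontfun (\<Phi> \<psi>) t = u \<psi> (clamp 0 T t)" for \<psi> t
    by (simp add: \<Phi>_def Bcontfun_inverse)
  have "dist (\<Phi> \<psi>) (\<Phi> \<eta>) \<le> 1/2 * dist \<psi> \<eta>" for \<psi> \<eta>
  proof (rule dist_bound)
    fix t' :: real
    define t where "t = clamp 0 T t'"
    have t: "t \<in> {0..T}"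
      using clamp_in_interval[of 0 T t'] \<open>0 \<le> T\<close> by (auto simp: t_def)
    let ?d = "dist \<psi> \<eta>"
    have int: "G \<psi> integrable_on {0..t}" for \<psi>
      using t by (intro integrable_continuous_real continuous_on_subset[OF contG]) auto
    \<comment> \<open>Source of the factor 1/2: integrating \<open>exp (2 * K * s)\<close> gains
      \<open>1 / (2 * K)\<close>, while the Lipschitz estimate costs at most
      \<open>K\<close>.\<close>
    have exp_int: "((\<lambda>s. K * ?d * exp (2 * K * s)) has_integral
        (?d / 2 * exp (2 * K * t) - ?d / 2 * exp (2 * K * 0))) {0..t}"
      using t K
      by (intro fundamental_theorem_of_calculus)
        (auto intro!: derivative_eq_intros simp: has_real_derivative_iff_has_vector_derivative[symmetric])
    have "norm (integral {0..t} (G \<psi>) - integral {0..t} (G \<eta>))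
        = norm (integral {0..t} (\<lambda>s. G \<psi> s - G \<eta> s))"
      by (simp add: integral_diff int)
    also have "\<dots> \<le> integral {0..t} (\<lambda>s. K * ?d * exp (2 * K * s))"
    proof (rule integral_norm_bound_integral)
      fix s assume "s \<in> {0..t}"
      then have "norm (G \<psi> s - G \<eta> s) \<le>
          L * norm (exp (2 * K * s) *\<^sub>R apply_bcontfun \<psi> s - exp (2 * K * s) *\<^sub>R apply_bcontfun \<eta> s)"
        unfolding G_def using t by (intro lipschitz_on_normD[OF lip]) auto
      also have "\<dots> = L * exp (2 * K * s) * dist (apply_bcontfun \<psi> s) (apply_bcontfun \<eta> s)"
        by (simp add: dist_norm scaleR_diff_right[symmetric])
      also have "\<dots> \<le> K * exp (2 * K * s) * ?d"
        using K \<open>0 \<le> L\<close> by (intro mult_mono dist_bounded) auto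
      finally show "norm (G \<psi> s - G \<eta> s) \<le> K * ?d * exp (2 * K * s)"
        by (simp add: mult_ac)
    qed (use int exp_int in \<open>auto intro: integrable_diff\<close>)
    also have "\<dots> = ?d / 2 * (exp (2 * K * t) - 1)"
      unfolding integral_unique[OF exp_int] by (simp add: algebra_simps)
    also have "\<dots> \<le> ?d / 2 * exp (2 * K * t)"
      by (intro mult_left_mono) auto
    finally have *: "norm (integral {0..t} (G \<psi>) - integral {0..t} (G \<eta>)) \<le> ?d / 2 * exp (2 * K * t)" .
    have "dist (u \<psi> t) (u \<eta> t) =
        exp (- (2 * K * t)) * norm (integral {0..t} (G \<psi>) - integral {0..t} (G \<eta>))"
      by (simp add: u_def dist_norm scaleR_diff_right[symmetric])
    also have "\<dots> \<le> exp (- (2 * K * t)) * (?d / 2 * exp (2 * K * t))"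
      by (intro mult_left_mono *) auto
    also have "\<dots> = 1/2 * ?d"
      by (simp add: exp_minus)
    finally show "dist (apply_bcontfun (\<Phi> \<psi>) t') (apply_bcontfun (\<Phi> \<eta>) t') \<le> 1/2 * ?d"
      by (simp add: \<Phi> t_def)
  qed
  then obtain \<psi> where fixp: "\<Phi> \<psi> = \<psi>"
    using banach_fix_type[of "1/2" \<Phi>] by auto
  \<comment> \<open>An indefinite integral of a continuous function is differentiable, so the
    solution is defined in this form. It agrees with the unweighted fixed point on
    \<open>{0..T}\<close>.\<close>
  define x where "x t = y + integral {0..t} (G \<psi>)" for t
  have x: "exp (2 * K * t) *\<^sub>R apply_bcontfun \<psi> t = x t" if "t \<in> {0..T}" for t
  proof -
    have "apply_bcontfun \<psi> t = u \<psi> t"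
      using \<Phi>[of \<psi> t] that by (simp add: fixp)
    then show ?thesis
      by (simp add: u_def x_def exp_minus)
  qed
  show thesis
  proof
    show "x 0 = y"
      by (simp add: x_def)
    fix t assume t: "t \<in> {0..T}"
    have "(x has_vector_derivative 0 + G \<psi> t) (at t within {0..T})"
      unfolding x_def
      by (intro derivative_intros integral_has_vector_derivative contG t)
    then show "(x has_vector_derivative F t (x t)) (at t within {0..T})"
      using x[OF t] by (simp add: G_def)
  qed
qed

text \<open>Time reversal \<open>t \<mapsto> T - t\<close> turns terminal data into initial data and
  negates the field. The adjoint functions, normalized at \<open>T\<close>, require this
  version.\<close>

lemma lipschitz_ode_terminal_solution_exists:
  fixes F :: "real \<Rightarrow> 'a::banach \<Rightarrow> 'a"
  assumes "0 \<le> T"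
    and cont: "continuous_on ({0..T} \<times> UNIV) (\<lambda>(t, x). F t x)"
    and lip: "\<And>t. t \<in> {0..T} \<Longrightarrow> L-lipschitz_on UNIV (F t)"
  obtains x where "x T = y"
    and "\<And>t. t \<in> {0..T} \<Longrightarrow> (x has_vector_derivative F t (x t)) (at t within {0..T})"
proof -
  have "continuous_on ({0..T} \<times> UNIV) (\<lambda>(t, x). - F (T - t) x)"
    unfolding case_prod_beta
    by (intro continuous_on_minus continuous_on_compose2[OF cont, of _ "\<lambda>z. (T - fst z, snd z)", simplified])
      (auto intro!: continuous_intros)
  moreover have "L-lipschitz_on UNIV (\<lambda>x. - F (T - t) x)" if "t \<in> {0..T}" for t
    using lip[of "T - t"] that by simp
  ultimately obtain x where x0: "x 0 = y"
    and x: "\<And>t. t \<in> {0..T} \<Longrightarrow> (x has_vector_derivative - F (T - t) (x t)) (at t within {0..T})"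
    using lipschitz_ode_solution_exists[OF \<open>0 \<le> T\<close>, of "\<lambda>t x. - F (T - t) x" L y] by auto
  show thesis
  proof (rule that[of "\<lambda>t. x (T - t)"])
    show "x (T - T) = y"
      by (simp add: x0)
    fix t assume t: "t \<in> {0..T}"
    \<comment> \<open>The chain rule gives a derivative within the image of the interval; the
      reflection maps the interval onto itself.\<close>
    have img: "(\<lambda>t. T - t) ` {0..T} = {0..T}"
      by (auto simp: image_iff intro!: bexI[of _ "T - _"])
    have "((\<lambda>t. T - t) has_vector_derivative - 1) (at t within {0..T})"
      by (auto intro!: derivative_eq_intros)
    from vector_diff_chain_within[OF this, of x "- F t (x (T - t))"] x[of "T - t"] t
    show "((\<lambda>t. x (T - t)) has_vector_derivative F t (x (T - t))) (at t within {0..T})"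
      by (simp add: img o_def)
  qed
qed

section \<open>Dependence of solutions on initial values\<close>

text \<open>Gronwall: \<open>exp (-2 L t) |z - x|\<^sup>2\<close> is nonincreasing.\<close>

lemma ode_solutions_dist_le:
  fixes x z :: "real \<Rightarrow> 'a::real_inner"
  assumes x: "\<And>t. t \<in> {0..T} \<Longrightarrow> (x has_vector_derivative F t (x t)) (at t within {0..T})"
    and z: "\<And>t. t \<in> {0..T} \<Longrightarrow> (z has_vector_derivative F t (z t)) (at t within {0..T})"
    and lip: "\<And>t. t \<in> {0..T} \<Longrightarrow> L-lipschitz_on X (F t)"
    and X: "\<And>t. t \<in> {0..T} \<Longrightarrow> x t \<in> X" "\<And>t. t \<in> {0..T} \<Longrightarrow> z t \<in> X"
    and t: "t \<in> {0..T}"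
  shows "norm (z t - x t) \<le> norm (z 0 - x 0) * exp (L * t)"
proof -
  define w where "w s = z s - x s" for s
  define v where "v s = exp (- (2 * L * s)) * (w s \<bullet> w s)" for s
  have w: "(w has_vector_derivative F s (z s) - F s (x s)) (at s within {0..T})" if "s \<in> {0..T}" for s
    unfolding w_def using that by (intro derivative_intros x z)
  have "v t \<le> v 0"
  proof (rule DERIV_nonpos_imp_decreasing_open[of 0 t v])
    have "continuous_on {0..T} w"
      using w by (intro continuous_on_vector_derivative)
    then have "continuous_on {0..t} w"
      using t by (auto elim: continuous_on_subset)
    then show "continuous_on {0..t} v"
      unfolding v_def by (intro continuous_intros)
    fix s assume s: "0 < s" "s < t"
    let ?D = "F s (z s) - F s (x s)"
    \<comment> \<open>The monotonicity criterion asks for derivatives only on the open interval,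
      where the derivative within \<open>{0..T}\<close> is two-sided.\<close>
    have "(w has_vector_derivative ?D) (at s)"
      using w[of s] s t at_within_interior[of s "{0..T}"] by auto
    then have "(v has_derivative (\<lambda>h. h * (exp (- (2 * L * s)) * (2 * (w s \<bullet> ?D) - 2 * L * (w s \<bullet> w s))))) (at s)"
      unfolding v_def has_vector_derivative_def
      by (auto intro!: derivative_eq_intros simp: algebra_simps inner_commute)
    then have "DERIV v s :> exp (- (2 * L * s)) * (2 * (w s \<bullet> ?D) - 2 * L * (w s \<bullet> w s))"
      by (simp add: has_field_derivative_def mult.commute[of "_ * _"] mult_commute_abs)
    moreover have "w s \<bullet> ?D \<le> L * (w s \<bullet> w s)"
    proof -
      have "w s \<bullet> ?D \<le> norm (w s) * norm ?D"
        by (rule norm_cauchy_schwarz)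
      also have "\<dots> \<le> norm (w s) * (L * norm (w s))"
        using s t X unfolding w_def by (intro mult_left_mono lipschitz_on_normD[OF lip]) auto
      also have "\<dots> = L * (w s \<bullet> w s)"
        by (simp add: power2_norm_eq_inner[symmetric] power2_eq_square)
      finally show ?thesis .
    qed
    ultimately show "\<exists>y. DERIV v s :> y \<and> y \<le> 0"
      by (intro exI[of _ "exp (- (2 * L * s)) * (2 * (w s \<bullet> ?D) - 2 * L * (w s \<bullet> w s))"])
        (auto intro: mult_nonneg_nonpos)
  qed (use t in auto)
  then have "(norm (w t))\<^sup>2 \<le> exp (2 * L * t) * (norm (w 0))\<^sup>2"
    by (simp add: v_def power2_norm_eq_inner[symmetric] exp_minus field_simps)
  also have "\<dots> = (norm (w 0) * exp (L * t))\<^sup>2"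
    by (simp add: power_mult_distrib exp_double[symmetric] mult_ac)
  finally show ?thesis
    unfolding w_def by (rule power2_le_imp_le) simp
qed

section \<open>Uniform estimates from second-order smoothness\<close>

text \<open>The derivative in \<open>x\<close> is the total derivative restricted to directions
  \<open>(0, h)\<close>. On the compact convex set \<open>{0..T} \<times> cball 0 R\<close>, a bound
  on the first derivative gives the Lipschitz constant and a bound on the second gives the quadratic
  remainder.\<close>

lemma twice_continuously_differentiable_on_bounds:
  fixes f :: "real \<Rightarrow> real^'n \<Rightarrow> real^'n"
  assumes "twice_continuously_differentiable_on (\<lambda>(t, x). f t x) ({0..T} \<times> UNIV)"
  shows twice_continuously_differentiable_on_continuous:
      "continuous_on ({0..T} \<times> UNIV) (\<lambda>(t, x). f t x)"
    and twice_continuously_differentiable_on_continuous_jacobian: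
      "continuous_on ({0..T} \<times> UNIV) (\<lambda>(t, x). jacobian (f t) (at x))"
    and twice_continuously_differentiable_on_lipschitz_cball:
      "\<And>R. \<exists>L. \<forall>t\<in>{0..T}. L-lipschitz_on (cball 0 R) (f t)"
    and twice_continuously_differentiable_on_quadratic_remainder:
      "\<And>R. \<exists>C\<ge>0. \<forall>t\<in>{0..T}. \<forall>x\<in>cball 0 R. \<forall>z\<in>cball 0 R.
        norm (f t z - f t x - jacobian (f t) (at x) *v (z - x)) \<le> C * (norm (z - x))\<^sup>2"
proof -
  let ?g = "\<lambda>(t, x). f t x" and ?S = "{0..T} \<times> (UNIV :: (real^'n) set)"
  obtain g' :: "real \<times> (real^'n) \<Rightarrow> (real \<times> (real^'n)) \<Rightarrow>\<^sub>L (real^'n)"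
    and g'' :: "real \<times> (real^'n) \<Rightarrow> (real \<times> (real^'n)) \<Rightarrow>\<^sub>L (real \<times> (real^'n)) \<Rightarrow>\<^sub>L (real^'n)" where
    g': "\<And>z. z \<in> ?S \<Longrightarrow> (?g has_derivative blinfun_apply (g' z)) (at z within ?S)" and
    g'': "\<And>z. z \<in> ?S \<Longrightarrow> (g' has_derivative blinfun_apply (g'' z)) (at z within ?S)" and
    contg'': "continuous_on ?S g''"
    using assms unfolding twice_continuously_differentiable_on_def by blast
  show "continuous_on ?S ?g"
    using g' by (rule has_derivative_continuous_on)
  have contg': "continuous_on ?S g'"
    using g'' by (rule has_derivative_continuous_on)
  \<comment> \<open>The second factor of the domain is the whole space, so the slice at fixed
    \<open>t\<close> has a full derivative, even when \<open>t\<close> is an endpoint of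
    \<open>{0..T}\<close>.\<close>
  have D: "(f t has_derivative (\<lambda>h. g' (t, x) (0, h))) (at x)" if "t \<in> {0..T}" for t x
  proof -
    have "(Pair t has_derivative (\<lambda>h. (0, h))) (at x)"
      by (auto intro!: derivative_eq_intros)
    from has_derivative_in_compose2[of ?S ?g "\<lambda>z. blinfun_apply (g' z)" "Pair t" UNIV x "\<lambda>h. (0, h)"]
    show ?thesis
      using that g' by (simp add: \<open>(Pair t has_derivative (\<lambda>h. (0, h))) (at x)\<close> image_subset_iff)
  qed
  have jac: "jacobian (f t) (at x) = matrix (\<lambda>h. g' (t, x) (0, h))" if "t \<in> {0..T}" for t x
    using frechet_derivative_at[OF D[OF that, of x]] by (simp add: jacobian_def)
  have D': "(f t has_derivative (\<lambda>h. jacobian (f t) (at x) *v h)) (at x)" if "t \<in> {0..T}" for t x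
    using D[OF that] by (subst jacobian_works[symmetric]) (rule differentiableI)
  have jac_mult: "jacobian (f t) (at x) *v h = g' (t, x) (0, h)" if "t \<in> {0..T}" for t x h
    using has_derivative_unique[OF D'[OF that] D[OF that]] by meson
  have "continuous_on ?S (\<lambda>z. matrix (\<lambda>h. g' z (0, h)))"
    unfolding matrix_def
    by (intro continuous_intros continuous_on_vec_lambda contg')
  then show "continuous_on ?S (\<lambda>(t, x). jacobian (f t) (at x))"
    by (rule continuous_on_eq) (auto simp: jac)
  have onorm_slice: "onorm (\<lambda>h. blinfun_apply A (0, h)) \<le> norm A" for A :: "(real \<times> (real^'n)) \<Rightarrow>\<^sub>L (real^'n)"
    using norm_blinfun[of A "(0, _)"] by (intro onorm_le) (simp add: norm_Pair)
  fix R :: real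
  let ?K = "{0..T} \<times> cball (0 :: real^'n) R"
  have K: "compact ?K" "convex ?K" "?K \<subseteq> ?S"
    by (auto intro: compact_Times convex_Times)
  obtain L where L: "\<And>z. z \<in> ?K \<Longrightarrow> norm (g' z) \<le> L" "0 < L"
    using compact_imp_bounded[OF compact_continuous_image[OF continuous_on_subset[OF contg' K(3)] K(1)]]
    by (auto simp: bounded_pos)
  obtain C where C: "\<And>z. z \<in> ?K \<Longrightarrow> norm (g'' z) \<le> C" "0 < C"
    using compact_imp_bounded[OF compact_continuous_image[OF continuous_on_subset[OF contg'' K(3)] K(1)]]
    by (auto simp: bounded_pos)
  have "L-lipschitz_on (cball 0 R) (f t)" if "t \<in> {0..T}" for t
  proof (rule bounded_derivative_imp_lipschitz)
    fix x :: "real^'n" assume "x \<in> cball 0 R"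
    then show "onorm (\<lambda>h. blinfun_apply (g' (t, x)) (0, h)) \<le> L"
      using L(1)[of "(t, x)"] that by (intro order_trans[OF onorm_slice]) auto
    show "(f t has_derivative (\<lambda>h. g' (t, x) (0, h))) (at x within cball 0 R)"
      using D[OF that] by (rule has_derivative_at_withinI)
  qed (use L in auto)
  then show "\<exists>L. \<forall>t\<in>{0..T}. L-lipschitz_on (cball 0 R) (f t)"
    by blast
  have g'_lip: "norm (g' z - g' w) \<le> C * norm (z - w)" if "z \<in> ?K" "w \<in> ?K" for z w
  proof (rule differentiable_bound[OF K(2)])
    fix z assume z: "z \<in> ?K"
    show "(g' has_derivative blinfun_apply (g'' z)) (at z within ?K)"
      using g'' z K(3) by (blast intro: has_derivative_subset)
    show "onorm (blinfun_apply (g'' z)) \<le> C"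
      using C(1)[OF z] by (simp add: norm_blinfun.rep_eq)
  qed (use that in auto)
  have remainder: "norm (f t z - f t x - jacobian (f t) (at x) *v (z - x)) \<le> C * (norm (z - x))\<^sup>2"
    if t: "t \<in> {0..T}" and x: "x \<in> cball 0 R" and z: "z \<in> cball 0 R" for t x z
  proof -
    \<comment> \<open>Along the segment the derivative of \<open>f t\<close> differs from its value
      at \<open>x\<close> by at most \<open>C * norm (z - x)\<close>; the mean value inequality
      contributes the second factor \<open>norm (z - x)\<close>.\<close>
    have "norm (f t z - f t x - g' (t, x) (0, z - x)) \<le> norm (z - x) * (C * norm (z - x))"
    proof (rule differentiable_bound_linearization[of x z "closed_segment x z" "f t"
          "\<lambda>u h. g' (t, u) (0, h)" x])
      fix u assume u: "u \<in> closed_segment x z"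
      show "(f t has_derivative (\<lambda>h. g' (t, u) (0, h))) (at u within closed_segment x z)"
        using D[OF t] by (rule has_derivative_at_withinI)
      have uR: "u \<in> cball 0 R"
        using u x z closed_segment_subset[OF x z convex_cball] by auto
      have "onorm (\<lambda>h. g' (t, u) (0, h) - g' (t, x) (0, h)) \<le> norm (g' (t, u) - g' (t, x))"
        using onorm_slice[of "g' (t, u) - g' (t, x)"] by (simp add: blinfun.diff_left)
      also have "\<dots> \<le> C * norm ((t, u) - (t, x))"
        using t x uR by (intro g'_lip) auto
      also have "\<dots> \<le> C * norm (z - x)"
        using C(2) segment_bound1[OF u] by (auto simp: norm_Pair)
      finally show "onorm ((\<lambda>h. blinfun_apply (g' (t, u)) (0, h)) - (\<lambda>h. blinfun_apply (g' (t, x)) (0, h)))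
          \<le> C * norm (z - x)"
        by (simp add: fun_diff_def)
    next
      show "x \<in> closed_segment x z"
        by simp
      show "x + s *\<^sub>R (z - x) \<in> closed_segment x z" if "s \<in> {0..1}" for s
        using that unfolding in_segment by (intro exI[of _ s]) (simp add: algebra_simps)
    qed
    then show ?thesis
      using t by (simp add: jac_mult power2_eq_square mult_ac)
  qed
  show "\<exists>C\<ge>0. \<forall>t\<in>{0..T}. \<forall>x\<in>cball 0 R. \<forall>z\<in>cball 0 R.
      norm (f t z - f t x - jacobian (f t) (at x) *v (z - x)) \<le> C * (norm (z - x))\<^sup>2"
    using remainder C(2) by (intro exI[of _ C] conjI ballI) simp_all
qed

section \<open>Uniqueness and local existence for the initial value problem\<close>

lemma ivp_solutionD:
  assumes "ivp_solution f T y x"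
  shows "x 0 = y"
    and "\<And>t. t \<in> {0..T} \<Longrightarrow> (x has_vector_derivative f t (x t)) (at t within {0..T})"
    and "continuous_on {0..T} x"
  using assms unfolding ivp_solution_def by (auto intro: continuous_on_vector_derivative)

text \<open>Both trajectories are compact and so lie in a common ball. There \<open>f\<close> is
  Lipschitz uniformly in time, and the Gronwall estimate with zero initial difference forces
  equality.\<close>

lemma ivp_solution_unique:
  fixes f :: "real \<Rightarrow> real^'n \<Rightarrow> real^'n"
  assumes lip: "\<And>R. \<exists>L. \<forall>t\<in>{0..T}. L-lipschitz_on (cball 0 R) (f t)"
    and x: "ivp_solution f T y x" and z: "ivp_solution f T y z" and t: "t \<in> {0..T}"
  shows "z t = x t"
proof -
  have "compact (x ` {0..T} \<union> z ` {0..T})"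
    using ivp_solutionD(3)[OF x] ivp_solutionD(3)[OF z]
    by (intro compact_Un compact_continuous_image) auto
  then obtain R where R: "\<And>u. u \<in> x ` {0..T} \<union> z ` {0..T} \<Longrightarrow> norm u \<le> R"
    using compact_imp_bounded[of "x ` {0..T} \<union> z ` {0..T}"] unfolding bounded_iff by blast
  obtain L where "\<And>t. t \<in> {0..T} \<Longrightarrow> L-lipschitz_on (cball 0 R) (f t)"
    using lip by blast
  from ode_solutions_dist_le[OF ivp_solutionD(2)[OF x] ivp_solutionD(2)[OF z] this _ _ t] R
  show ?thesis
    by (simp add: ivp_solutionD(1)[OF x] ivp_solutionD(1)[OF z])
qed

text \<open>Truncating \<open>f\<close> by the nearest-point projection onto a large ball makes it globally
  Lipschitz; solutions starting close to \<open>x 0\<close> never feel the truncation.\<close>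

lemma ivp_solution_exists_nearby:
  fixes f :: "real \<Rightarrow> real^'n \<Rightarrow> real^'n"
  assumes T: "0 \<le> T"
    and cont: "continuous_on ({0..T} \<times> UNIV) (\<lambda>(t, x). f t x)"
    and lip: "\<And>t. t \<in> {0..T} \<Longrightarrow> L-lipschitz_on (cball 0 (R + 1)) (f t)"
    and x: "ivp_solution f T x0 x" and R: "\<And>t. t \<in> {0..T} \<Longrightarrow> norm (x t) \<le> R"
    and y: "norm (y - x0) \<le> exp (- (L * T))"
  obtains z where "ivp_solution f T y z"
    and "\<And>t. t \<in> {0..T} \<Longrightarrow> norm (z t) \<le> R + 1"
    and "\<And>t. t \<in> {0..T} \<Longrightarrow> norm (z t - x t) \<le> norm (y - x0) * exp (L * T)"
proof -
  let ?B = "cball (0 :: real^'n) (R + 1)"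
  have "0 \<le> R"
    using R[of 0] T norm_ge_zero[of "x 0"] by (meson atLeastAtMost_iff order.refl order_trans)
  then have B: "convex ?B" "closed ?B" "?B \<noteq> {}"
    by auto
  have "0 \<le> L"
    using lipschitz_on_nonneg[OF lip[of 0]] T by simp
  define \<pi> where "\<pi> = closest_point ?B"
  have \<pi>: "\<pi> u \<in> ?B" for u
    unfolding \<pi>_def by (rule closest_point_in_set) (use B in auto)
  have \<pi>_id: "\<pi> u = u" if "u \<in> ?B" for u
    unfolding \<pi>_def using that by (rule closest_point_self)
  have "continuous_on ({0..T} \<times> UNIV) (\<lambda>z. \<pi> (snd z))"
    unfolding \<pi>_def by (rule continuous_on_compose2[OF continuous_on_closest_point[OF B, of UNIV]])
      (auto intro: continuous_intros)
  then have cont\<pi>: "continuous_on ({0..T} \<times> UNIV) (\<lambda>(t, x). f t (\<pi> x))"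
    unfolding case_prod_beta
    by (intro continuous_on_compose2[OF cont, of _ "\<lambda>z. (fst z, \<pi> (snd z))", simplified])
      (auto intro!: continuous_intros)
  \<comment> \<open>Projection onto a closed convex set is nonexpansive, so truncation preserves the
    constant \<open>L\<close>.\<close>
  have lip\<pi>: "L-lipschitz_on UNIV (\<lambda>x. f t (\<pi> x))" if "t \<in> {0..T}" for t
  proof (rule lipschitz_onI)
    fix u v
    have "dist (f t (\<pi> u)) (f t (\<pi> v)) \<le> L * dist (\<pi> u) (\<pi> v)"
      using lipschitz_onD[OF lip[OF that] \<pi> \<pi>] .
    also have "\<dots> \<le> L * dist u v"
      unfolding \<pi>_def using \<open>0 \<le> L\<close> by (intro mult_left_mono closest_point_lipschitz B)
    finally show "dist (f t (\<pi> u)) (f t (\<pi> v)) \<le> L * dist u v" .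
  qed fact
  obtain z where z0: "z 0 = y"
    and z: "\<And>t. t \<in> {0..T} \<Longrightarrow> (z has_vector_derivative f t (\<pi> (z t))) (at t within {0..T})"
    using lipschitz_ode_solution_exists[OF T cont\<pi> lip\<pi>] by blast
  \<comment> \<open>The reference solution stays where \<open>\<pi>\<close> is the identity, so it
    also solves the truncated equation and can be compared with \<open>z\<close> there.\<close>
  have x': "(x has_vector_derivative f t (\<pi> (x t))) (at t within {0..T})" if "t \<in> {0..T}" for t
    using ivp_solutionD(2)[OF x that] R[OF that] by (simp add: \<pi>_id)
  have dist: "norm (z t - x t) \<le> norm (y - x0) * exp (L * T)" if t: "t \<in> {0..T}" for t
  proof -
    have "norm (z t - x t) \<le> norm (y - x0) * exp (L * t)"
      using ode_solutions_dist_le[where F = "\<lambda>t u. f t (\<pi> u)", OF x' z lip\<pi> _ _ t]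
      by (simp add: z0 ivp_solutionD(1)[OF x])
    also have "\<dots> \<le> norm (y - x0) * exp (L * T)"
      using t \<open>0 \<le> L\<close> by (intro mult_left_mono) (auto intro: mult_left_mono)
    finally show ?thesis .
  qed
  \<comment> \<open>The radius \<open>exp (- (L * T))\<close> is chosen so that the deviation stays
    within 1, the margin between the balls of radius \<open>R\<close> and
    \<open>R + 1\<close>.\<close>
  have "norm (y - x0) * exp (L * T) \<le> 1"
    using mult_right_mono[OF y, of "exp (L * T)"] by (simp add: exp_minus)
  then have zR: "norm (z t) \<le> R + 1" if "t \<in> {0..T}" for t
    using dist[OF that] R[OF that] norm_triangle_sub[of "z t" "x t"] by linarith
  show thesis
  proof
    show "ivp_solution f T y z"
      unfolding ivp_solution_def using z z0 zR by (simp add: \<pi>_id)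
  qed (use dist zR in auto)
qed

section \<open>The adjoint system and its pairing with differences of solutions\<close>

text \<open>The norm of a matrix is here the Euclidean norm of its row norms, so Cauchy-Schwarz on
  each row suffices.\<close>

lemma norm_matrix_vector_mult_le:
  fixes A :: "real^'n^'m"
  shows "norm (A *v x) \<le> norm A * norm x"
proof -
  have "norm (A *v x) \<le> L2_set (\<lambda>i. norm (A $ i) * norm x) UNIV"
    unfolding norm_vec_def[of "A *v x"]
    by (rule L2_set_mono) (auto simp: matrix_vector_mul_component Cauchy_Schwarz_ineq2)
  also have "\<dots> = norm A * norm x"
    by (simp add: L2_set_left_distrib[symmetric] norm_vec_def)
  finally show ?thesis .
qed

text \<open>The adjoint field is linear in \<open>p\<close>, and its continuous coefficient matrix
  is bounded on \<open>{0..T}\<close>; that bound is a global Lipschitz constant.\<close>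

lemma adjoint_function_exists:
  fixes f :: "real \<Rightarrow> real^'n \<Rightarrow> real^'n"
  assumes T: "0 \<le> T"
    and cont: "continuous_on {0..T} (\<lambda>t. jacobian (f t) (at (x t)))"
  obtains p where "adjoint_function f T x p" and "p T = y"
proof -
  let ?A = "\<lambda>t. transpose (jacobian (f t) (at (x t)))"
  let ?F = "\<lambda>t p. - (?A t *v p)"
  have contA: "continuous_on {0..T} ?A"
    unfolding transpose_def
    by (intro continuous_on_vec_lambda continuous_on_component cont)
  have "continuous_on ({0..T} \<times> UNIV) (\<lambda>z. ?A (fst z))"
    by (rule continuous_on_compose2[OF contA]) (auto intro: continuous_intros)
  then have contF: "continuous_on ({0..T} \<times> UNIV) (\<lambda>(t, p). ?F t p)"
    unfolding case_prod_beta matrix_vector_mult_def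
    by (intro continuous_intros continuous_on_vec_lambda continuous_on_component)
  have "compact (?A ` {0..T})"
    by (intro compact_continuous_image contA) simp
  from compact_imp_bounded[OF this]
  obtain M where M: "\<And>t. t \<in> {0..T} \<Longrightarrow> norm (?A t) \<le> M" "0 < M"
    unfolding bounded_pos by blast
  have "M-lipschitz_on UNIV (?F t)" if t: "t \<in> {0..T}" for t
  proof (rule lipschitz_onI)
    fix p q
    have "norm (?A t *v (q - p)) \<le> norm (?A t) * norm (q - p)"
      by (rule norm_matrix_vector_mult_le)
    also have "\<dots> \<le> M * norm (q - p)"
      by (intro mult_right_mono M t) simp
    finally show "dist (?F t p) (?F t q) \<le> M * dist p q"
      by (simp add: dist_norm matrix_vector_mult_diff_distrib norm_minus_commute)
  qed (use M in simp)
  then obtain p where "p T = y"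
    and "\<And>t. t \<in> {0..T} \<Longrightarrow> (p has_vector_derivative ?F t (p t)) (at t within {0..T})"
    using lipschitz_ode_terminal_solution_exists[OF T contF, of M y] by metis
  then show thesis
    by (intro that[of p]) (auto simp: adjoint_function_def)
qed

text \<open>Moving the transpose across the inner product leaves \<open>p t\<close> paired with the
  linearization remainder as the derivative of the pairing. Cauchy-Schwarz and the mean value
  inequality finish.\<close>

lemma adjoint_pairing_bound:
  fixes f :: "real \<Rightarrow> real^'n \<Rightarrow> real^'n"
  assumes T: "0 \<le> T"
    and x: "ivp_solution f T x0 x" and z: "ivp_solution f T y z"
    and p: "adjoint_function f T x p"
    and rem: "\<And>t. t \<in> {0..T} \<Longrightarrow>
      norm (f t (z t) - f t (x t) - jacobian (f t) (at (x t)) *v (z t - x t)) \<le> e"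
    and M: "\<And>t. t \<in> {0..T} \<Longrightarrow> norm (p t) \<le> M"
  shows "\<bar>p T \<bullet> (z T - x T) - p 0 \<bullet> (y - x0)\<bar> \<le> M * e * T"
proof -
  let ?r = "\<lambda>t. f t (z t) - f t (x t) - jacobian (f t) (at (x t)) *v (z t - x t)"
  define \<phi> where "\<phi> t = p t \<bullet> (z t - x t)" for t
  have "norm (\<phi> T - \<phi> 0) \<le> M * e * norm (T - 0)"
  proof (rule differentiable_bound)
    fix t assume t: "t \<in> {0..T}"
    let ?A = "jacobian (f t) (at (x t))"
    have "(p has_vector_derivative - (transpose ?A *v p t)) (at t within {0..T})"
      using p t by (simp add: adjoint_function_def)
    then have "(\<phi> has_vector_derivative
        p t \<bullet> (f t (z t) - f t (x t)) + - (transpose ?A *v p t) \<bullet> (z t - x t)) (at t within {0..T})"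
      unfolding \<phi>_def
      by (intro bounded_bilinear.has_vector_derivative[OF bounded_bilinear_inner] derivative_intros
          ivp_solutionD(2)[OF x t] ivp_solutionD(2)[OF z t])
    also have "p t \<bullet> (f t (z t) - f t (x t)) + - (transpose ?A *v p t) \<bullet> (z t - x t) = p t \<bullet> ?r t"
      by (simp add: dot_lmul_matrix[symmetric] inner_diff_right)
    finally show "(\<phi> has_derivative (\<lambda>h. h *\<^sub>R (p t \<bullet> ?r t))) (at t within {0..T})"
      by (simp add: has_vector_derivative_def)
    have "\<bar>p t \<bullet> ?r t\<bar> \<le> norm (p t) * norm (?r t)"
      by (rule Cauchy_Schwarz_ineq2)
    also have "\<dots> \<le> M * e"
      using order_trans[OF norm_ge_zero M[OF t]] by (intro mult_mono rem M t) auto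
    finally show "onorm (\<lambda>h. h *\<^sub>R (p t \<bullet> ?r t)) \<le> M * e"
      by (intro onorm_le) (simp add: abs_mult mult.commute mult_left_mono)
  qed (use T in auto)
  then show ?thesis
    using T by (simp add: \<phi>_def ivp_solutionD(1)[OF x] ivp_solutionD(1)[OF z])
qed

section \<open>Differentiability of the endpoint map\<close>

lemma has_derivative_of_quadratic_bound:
  fixes S :: "'a::real_normed_vector \<Rightarrow> 'b::real_normed_vector"
  assumes "bounded_linear S'" and "0 < \<delta>"
    and bound: "\<And>y. norm (y - a) \<le> \<delta> \<Longrightarrow> norm (S y - S a - S' (y - a)) \<le> Q * (norm (y - a))\<^sup>2"
  shows "(S has_derivative S') (at a)"
proof (rule has_derivativeI_sandwich[OF \<open>0 < \<delta>\<close> assms(1), where H = "\<lambda>y. Q * norm (y - a)"])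
  fix y assume "y \<noteq> a" "dist y a < \<delta>"
  then show "norm (S y - S a - S' (y - a)) / norm (y - a) \<le> Q * norm (y - a)"
    using bound[of y] by (simp add: dist_norm divide_le_eq power2_eq_square mult.assoc)
next
  show "((\<lambda>y. Q * norm (y - a)) \<longlongrightarrow> 0) (at a)"
    by (auto intro!: tendsto_eq_intros)
qed

text \<open>The interior condition ensures that near \<open>x0\<close> the map
  \<open>ivp_sol\<close> takes genuine solution values rather than unspecified ones.
  Differentiability is stated separately because \<open>jacobian\<close> is a total
  function.\<close>

theorem theorem4p1:
  fixes f :: "real \<Rightarrow> real^'n \<Rightarrow> real^'n"
    and T :: real
    and x0 :: "real^'n"
  assumes "T > 0"
    and "twice_continuously_differentiable_on (\<lambda>(t, x). f t x) ({0..T} \<times> UNIV)"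
    and "\<exists>x. ivp_solution f T x0 x"
  shows "x0 \<in> interior {y. \<exists>x. ivp_solution f T y x}
    \<and> (\<lambda>y. ivp_sol f T y T) differentiable (at x0)
    \<and> jacobian (\<lambda>y. ivp_sol f T y T) (at x0)
        = transpose (adjoint_matrix f T (ivp_sol f T x0) 0)"
proof -
  note C2 = assms(2)
  have T: "0 \<le> T" "T \<in> {0..T}"
    using \<open>T > 0\<close> by auto
  note lip = twice_continuously_differentiable_on_lipschitz_cball[OF C2]
  have sol: "ivp_solution f T y (ivp_sol f T y)" if "\<exists>z. ivp_solution f T y z" for y
    unfolding ivp_sol_def using that by (rule someI_ex)
  define x where "x = ivp_sol f T x0"
  have x: "ivp_solution f T x0 x"
    unfolding x_def using assms(3) by (rule sol)
  have contx: "continuous_on {0..T} x"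
    by (rule ivp_solutionD(3)[OF x])
  obtain R where R: "\<And>t. t \<in> {0..T} \<Longrightarrow> norm (x t) \<le> R"
    using compact_imp_bounded[OF compact_continuous_image[OF contx]] unfolding bounded_iff by blast
  obtain L where L: "\<And>t. t \<in> {0..T} \<Longrightarrow> L-lipschitz_on (cball 0 (R + 1)) (f t)"
    using lip by blast
  obtain C where "0 \<le> C" and C: "\<And>t u v. \<lbrakk>t \<in> {0..T}; u \<in> cball 0 (R + 1); v \<in> cball 0 (R + 1)\<rbrakk>
      \<Longrightarrow> norm (f t v - f t u - jacobian (f t) (at u) *v (v - u)) \<le> C * (norm (v - u))\<^sup>2"
    using twice_continuously_differentiable_on_quadratic_remainder[OF C2, of "R + 1"] by blast
  define \<delta> where "\<delta> = exp (- (L * T))"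
  have "\<delta> > 0"
    by (simp add: \<delta>_def)
  have near: "\<exists>z. ivp_solution f T y z"
      "\<And>t. t \<in> {0..T} \<Longrightarrow> ivp_sol f T y t \<in> cball 0 (R + 1)"
      "\<And>t. t \<in> {0..T} \<Longrightarrow> norm (ivp_sol f T y t - x t) \<le> norm (y - x0) * exp (L * T)"
    if y: "norm (y - x0) \<le> \<delta>" for y
  proof -
    obtain z where z: "ivp_solution f T y z"
      and zR: "\<And>t. t \<in> {0..T} \<Longrightarrow> norm (z t) \<le> R + 1"
      and dist: "\<And>t. t \<in> {0..T} \<Longrightarrow> norm (z t - x t) \<le> norm (y - x0) * exp (L * T)"
      using ivp_solution_exists_nearby[OF T(1) twice_continuously_differentiable_on_continuous[OF C2]
          L x R y[unfolded \<delta>_def]] by blast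
    show ex: "\<exists>z. ivp_solution f T y z"
      using z by blast
    fix t assume t: "t \<in> {0..T}"
    \<comment> \<open>Uniqueness transfers the bounds from the constructed solution to the one
      selected by choice.\<close>
    have "ivp_sol f T y t = z t"
      using ivp_solution_unique[OF lip z sol[OF ex] t] .
    then show "ivp_sol f T y t \<in> cball 0 (R + 1)"
      and "norm (ivp_sol f T y t - x t) \<le> norm (y - x0) * exp (L * T)"
      using zR[OF t] dist[OF t] by auto
  qed
  have "cball x0 \<delta> \<subseteq> {y. \<exists>x. ivp_solution f T y x}"
    using near(1) by (auto simp: dist_norm norm_minus_commute)
  then have interior: "x0 \<in> interior {y. \<exists>x. ivp_solution f T y x}"
    using \<open>\<delta> > 0\<close> by (meson ball_subset_cball mem_interior order_trans)
  define p where "p = adjoint_basis f T x"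
  have "continuous_on {0..T} (\<lambda>t. (t, x t))" "(\<lambda>t. (t, x t)) ` {0..T} \<subseteq> {0..T} \<times> UNIV"
    by (auto intro: continuous_intros contx)
  then have contJ: "continuous_on {0..T} (\<lambda>t. jacobian (f t) (at (x t)))"
    using continuous_on_compose2[OF twice_continuously_differentiable_on_continuous_jacobian[OF C2],
        of "{0..T}" "\<lambda>t. (t, x t)"]
    by simp
  have p: "adjoint_function f T x (p j)" "p j T = axis j 1" for j
  proof -
    have "\<exists>q. adjoint_function f T x q \<and> q T = axis j 1"
      using adjoint_function_exists[OF T(1) contJ, of "axis j 1"] by blast
    from someI_ex[OF this] show "adjoint_function f T x (p j)" "p j T = axis j 1"
      by (simp_all add: p_def adjoint_basis_def)
  qed
  have "continuous_on {0..T} (p j)" for j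
    using p(1)[of j] unfolding adjoint_function_def by (auto intro: continuous_on_vector_derivative)
  \<comment> \<open>Finitely many indices \<open>j\<close> allow one bound \<open>M\<close> for all
    adjoint functions.\<close>
  then have "bounded (\<Union>j. p j ` {0..T})"
    by (intro compact_imp_bounded compact_UN compact_continuous_image) auto
  then obtain M where M: "\<And>j t. t \<in> {0..T} \<Longrightarrow> norm (p j t) \<le> M"
    unfolding bounded_iff by blast
  let ?P = "transpose (adjoint_matrix f T x 0)"
  let ?S = "\<lambda>y. ivp_sol f T y T"
  \<comment> \<open>This is the pairing bound \<open>M * e * T\<close> with
    \<open>e = C * (norm (y - x0) * exp (L * T))\<^sup>2\<close>, after taking out the square of
    \<open>norm (y - x0)\<close>.\<close>
  define Q where "Q = M * (C * (exp (L * T))\<^sup>2) * T"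
  have quad: "norm (?S y - ?S x0 - ?P *v (y - x0)) \<le> (real CARD('n) * Q) * (norm (y - x0))\<^sup>2"
    if y: "norm (y - x0) \<le> \<delta>" for y
  proof -
    let ?z = "ivp_sol f T y"
    have rem: "norm (f t (?z t) - f t (x t) - jacobian (f t) (at (x t)) *v (?z t - x t))
        \<le> C * (norm (y - x0) * exp (L * T))\<^sup>2" if t: "t \<in> {0..T}" for t
    proof -
      have "x t \<in> cball 0 (R + 1)"
        using R[OF t] by simp
      from C[OF t this near(2)[OF y t]] show ?thesis
        using mult_left_mono[OF power_mono[OF near(3)[OF y t] norm_ge_zero, of 2] \<open>0 \<le> C\<close>] by linarith
    qed
    have "\<bar>(?S y - ?S x0 - ?P *v (y - x0)) $ j\<bar> \<le> Q * (norm (y - x0))\<^sup>2" for j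
    proof -
      \<comment> \<open>After transposition the adjoint functions at time 0 are the rows, so each
        component of the product is an inner product with one of them.\<close>
      have "(?P *v (y - x0)) $ j = p j 0 \<bullet> (y - x0)"
        unfolding matrix_vector_mul_component
        by (rule arg_cong2[where f = inner]) (simp_all add: vec_eq_iff transpose_def adjoint_matrix_def p_def)
      then have "(?S y - ?S x0 - ?P *v (y - x0)) $ j = p j T \<bullet> (?z T - x T) - p j 0 \<bullet> (y - x0)"
        by (simp add: p(2) x_def inner_axis')
      then show ?thesis
        using adjoint_pairing_bound[OF T(1) x sol[OF near(1)[OF y]] p(1)[of j] rem M]
        by (simp add: Q_def power_mult_distrib mult_ac)
    qed
    \<comment> \<open>The Euclidean norm is at most the sum of the absolute components, hence the
      factor \<open>CARD('n)\<close>.\<close>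
    then have "(\<Sum>j\<in>UNIV. \<bar>(?S y - ?S x0 - ?P *v (y - x0)) $ j\<bar>)
        \<le> (\<Sum>j\<in>(UNIV :: 'n set). Q * (norm (y - x0))\<^sup>2)"
      by (intro sum_mono) auto
    then show ?thesis
      using norm_le_l1_cart[of "?S y - ?S x0 - ?P *v (y - x0)"] by simp
  qed
  have deriv: "(?S has_derivative (\<lambda>h. ?P *v h)) (at x0)"
    using quad by (rule has_derivative_of_quadratic_bound[OF matrix_vector_mul_bounded_linear \<open>\<delta> > 0\<close>])
  have "jacobian ?S (at x0) = ?P"
    unfolding jacobian_def frechet_derivative_at[OF deriv, symmetric]
    by (rule matrix_of_matrix_vector_mul)
  then show ?thesis
    using interior deriv by (auto simp: x_def intro: differentiableI)
qed

end
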